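(* Let $\mathbf{x}\in\mathbb{R}^{r_1}$, $\mathbf{y}\in\mathbb{R}^{r_2}$, $\mathbf{z}\in\mathbb{R}^{r_3}$ and let $\phi(\mathbf{x},\mathbf{y})=\bigvee_{k=1}^{K_\phi}\bigwedge_{i=1}^{m_k} f_{k,i}(\mathbf{x},\mathbf{y})\ge0$ and $\psi(\mathbf{x},\mathbf{z})=\bigvee_{k'=1}^{K_\psi}\bigwedge_{j=1}^{n_{k'}} g_{k',j}(\mathbf{x},\mathbf{z})\ge0$ with polynomials $f_{k,i}\in\mathbb{R}[\mathbf{x},\mathbf{y}]$, $g_{k',j}\in\mathbb{R}[\mathbf{x},\mathbf{z}]$. Let $T_\phi\subseteq\mathbb{R}^{r_1+r_2}$ and $T_\psi\subseteq\mathbb{R}^{r_1+r_3}$ be the sets of points satisfying $\phi$ and $\psi$, and let $P_{\mathbf{x}}(T_\phi)=\{\mathbf{x}\mid\exists\mathbf{y}.\,(\mathbf{x},\mathbf{y})\in T_\phi\}$, $P_{\mathbf{x}}(T_\psi)=\{\mathbf{x}\mid\exists\mathbf{z}.\,(\mathbf{x},\mathbf{z})\in T_\psi\}$. Let $T_1=\mathrm{cl}(P_{\mathbf{x}}(T_\phi))$ and $T_2=\mathrm{cl}(P_{\mathbf{x}}(T_\psi))$, written as finite unions of closed basic semialgebraic sets $T_1=\bigcup_i S_i$, $T_2=\bigcup_j S'_j$, and let $\tilde T_1=\bigcup_i\tilde S_i$, $\tilde T_2=\bigcup_j\tilde S'_j$. Assume $\tilde T_1\cap\tilde T_2=\emptyset$.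 Then there exist polynomials $h_1,h_2\in\mathbb{R}[\mathbf{x}]$ such that $h(\mathbf{x})=h_1(\mathbf{x})+\sqrt{\|\mathbf{x}\|^2+1}\,h_2(\mathbf{x})$ satisfies $h(\mathbf{x})>0$ for all $\mathbf{x}\in P_{\mathbf{x}}(T_\phi)$ and $-h(\mathbf{x})>0$ for all $\mathbf{x}\in P_{\mathbf{x}}(T_\psi)$. Consequently $h(\mathbf{x})>0$ is an interpolant of $\phi$ and $\psi$, i.e. $\phi(\mathbf{x},\mathbf{y})\models h(\mathbf{x})>0$ and $\psi(\mathbf{x},\mathbf{z})\models h(\mathbf{x})<0$.
   Context: $\mathrm{cl}$ denotes topological closure. For a closed basic semialgebraic set $S=\{\mathbf{x}\in\mathbb{R}^{r_1}\mid p_1(\mathbf{x})\ge0,\dots,p_m(\mathbf{x})\ge0\}$, $\tilde S=\{(x_0,\mathbf{x})\in\mathbb{R}^{r_1+1}\mid \tilde p_1\ge0,\dots,\tilde p_m\ge0,\ x_0\ge0,\ x_0^2+\|\mathbf{x}\|^2=1\}$, where for $f$ of total degree $d_f$, $\tilde f(x_0,\mathbf{x})=x_0^{d_f}f(\mathbf{x}/x_0)$ is its homogenization with a fresh variable $x_0$. *)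

theory Defs
  imports "HOL-Analysis.Analysis" "HOL-Library.Poly_Mapping"
begin

text \<open>Multivariate polynomials over the reals with variables in \<open>'v\<close>: finitely supported maps
  from monomials (finitely supported exponent vectors) to coefficients, with the ring structure
  of \<^theory>\<open>HOL-Library.Poly_Mapping\<close>.\<close>

type_synonym 'v monomial = "'v \<Rightarrow>\<^sub>0 nat"
type_synonym 'v rpoly = "'v monomial \<Rightarrow>\<^sub>0 real"

definition monomial_eval :: "('v \<Rightarrow> real) \<Rightarrow> 'v monomial \<Rightarrow> real" where
  "monomial_eval a m = (\<Prod>v\<in>Poly_Mapping.keys m. a v ^ Poly_Mapping.lookup m v)"

definition rpoly_eval :: "('v \<Rightarrow> real) \<Rightarrow> 'v rpoly \<Rightarrow> real" where
  "rpoly_eval a p = (\<Sum>m\<in>Poly_Mapping.keys p. Poly_Mapping.lookup p m * monomial_eval a m)"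

definition monomial_degree :: "'v monomial \<Rightarrow> nat" where
  "monomial_degree m = (\<Sum>v\<in>Poly_Mapping.keys m. Poly_Mapping.lookup m v)"

text \<open>The zero polynomial gets degree 0.\<close>

definition total_degree :: "'v rpoly \<Rightarrow> nat" where
  "total_degree p = Max (insert 0 (monomial_degree ` Poly_Mapping.keys p))"

text \<open>Homogenization; the fresh variable \<open>x\<^sub>0\<close> is \<open>None\<close>, an old variable \<open>v\<close> becomes \<open>Some v\<close>.\<close>

definition homogenize_monomial :: "nat \<Rightarrow> 'v monomial \<Rightarrow> 'v option monomial" where
  "homogenize_monomial d m =
     Poly_Mapping.single None (d - monomial_degree m) +
     (\<Sum>v\<in>Poly_Mapping.keys m. Poly_Mapping.single (Some v) (Poly_Mapping.lookup m v))"

definition homogenize :: "'v rpoly \<Rightarrow> 'v option rpoly" where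
  "homogenize p =
     (\<Sum>m\<in>Poly_Mapping.keys p.
        Poly_Mapping.single (homogenize_monomial (total_degree p) m) (Poly_Mapping.lookup p m))"

text \<open>A list of polynomials stands for the conjunction of the inequalities \<open>p \<ge> 0\<close>,
  a list of such lists for the disjunction of these conjunctions.\<close>

definition basic_sa_set :: "'n::finite rpoly list \<Rightarrow> (real ^ 'n) set" where
  "basic_sa_set ps = {x. \<forall>p\<in>set ps. rpoly_eval (($) x) p \<ge> 0}"

definition tilde_set :: "'n::finite rpoly list \<Rightarrow> (real \<times> (real ^ 'n)) set" where
  "tilde_set ps =
     {(x0, x). (\<forall>p\<in>set ps. rpoly_eval (case_option x0 (($) x)) (homogenize p) \<ge> 0) \<and>
        x0 \<ge> 0 \<and> x0\<^sup>2 + (norm x)\<^sup>2 = 1}"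

definition holds :: "('n::finite + 'm::finite) rpoly list list \<Rightarrow> real ^ 'n \<Rightarrow> real ^ 'm \<Rightarrow> bool" where
  "holds \<phi> x y \<longleftrightarrow>
     (\<exists>C\<in>set \<phi>. \<forall>f\<in>set C. rpoly_eval (case_sum (($) x) (($) y)) f \<ge> 0)"

definition solution_set :: "('n::finite + 'm::finite) rpoly list list \<Rightarrow> ((real ^ 'n) \<times> (real ^ 'm)) set"
  where "solution_set \<phi> = {(x, y). holds \<phi> x y}"

definition proj_x :: "('a \<times> 'b) set \<Rightarrow> 'a set" where
  "proj_x T = {x. \<exists>y. (x, y) \<in> T}"

lemma monomial_eval_superset:
  assumes "finite A" "Poly_Mapping.keys m \<subseteq> A"
  shows "monomial_eval a m = (\<Prod>v\<in>A. a v ^ Poly_Mapping.lookup m v)"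
  unfolding monomial_eval_def
  by (rule prod.mono_neutral_left) (use assms in \<open>auto simp: in_keys_iff\<close>)

lemma monomial_eval_zero [simp]: "monomial_eval a 0 = 1"
  by (simp add: monomial_eval_def)

lemma monomial_eval_single [simp]: "monomial_eval a (Poly_Mapping.single v n) = a v ^ n"
  by (simp add: monomial_eval_def)

lemma monomial_eval_add: "monomial_eval a (m + n) = monomial_eval a m * monomial_eval a n"
proof -
  let ?A = "Poly_Mapping.keys m \<union> Poly_Mapping.keys n"
  have "monomial_eval a (m + n) = (\<Prod>v\<in>?A. a v ^ Poly_Mapping.lookup (m + n) v)"
    by (rule monomial_eval_superset) (auto simp: in_keys_iff lookup_add)
  also have "\<dots> = (\<Prod>v\<in>?A. a v ^ Poly_Mapping.lookup m v) * (\<Prod>v\<in>?A. a v ^ Poly_Mapping.lookup n v)"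
    by (simp add: lookup_add power_add prod.distrib)
  finally show ?thesis
    by (simp add: monomial_eval_superset[of ?A m] monomial_eval_superset[of ?A n])
qed

lemma monomial_eval_sum: "monomial_eval a (sum f A) = (\<Prod>i\<in>A. monomial_eval a (f i))"
  by (induction A rule: infinite_finite_induct) (auto simp: monomial_eval_add)

lemma rpoly_eval_zero [simp]: "rpoly_eval a 0 = 0"
  by (simp add: rpoly_eval_def)

lemma rpoly_eval_single [simp]: "rpoly_eval a (Poly_Mapping.single m c) = c * monomial_eval a m"
  by (simp add: rpoly_eval_def)

lemma rpoly_eval_add: "rpoly_eval a (p + q) = rpoly_eval a p + rpoly_eval a q"
  unfolding rpoly_eval_def
  by (rule setsum_keys_plus_distrib[where f = "\<lambda>m c. c * monomial_eval a m"]) (auto simp: distrib_right)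

lemma rpoly_eval_sum: "rpoly_eval a (sum f A) = (\<Sum>i\<in>A. rpoly_eval a (f i))"
  by (induction A rule: infinite_finite_induct) (auto simp: rpoly_eval_add)

lemma rpoly_eval_homogenize:
  assumes "x0 \<noteq> 0"
  shows "rpoly_eval (case_option x0 a) (homogenize p) =
    x0 ^ total_degree p * rpoly_eval (\<lambda>v. a v / x0) p"
proof -
  have "monomial_eval (case_option x0 a) (homogenize_monomial (total_degree p) m) =
      x0 ^ total_degree p * monomial_eval (\<lambda>v. a v / x0) m"
    if "m \<in> Poly_Mapping.keys p" for m
  proof -
    have "monomial_degree m \<le> total_degree p"
      using that by (simp add: total_degree_def)
    then have "x0 ^ total_degree p = x0 ^ (total_degree p - monomial_degree m) * x0 ^ monomial_degree m"
      by (simp flip: power_add)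
    moreover have "monomial_eval (\<lambda>v. a v / x0) m = monomial_eval a m / x0 ^ monomial_degree m"
      by (simp add: monomial_eval_def monomial_degree_def power_divide prod_dividef power_sum)
    ultimately show ?thesis
      using assms
      by (simp add: homogenize_monomial_def monomial_eval_add monomial_eval_sum)
        (simp add: monomial_eval_def)
  qed
  then show ?thesis
    by (simp add: homogenize_def rpoly_eval_sum rpoly_eval_def[of "\<lambda>v. a v / x0"]
        sum_distrib_left mult.left_commute)
qed

end

theory Submission
  imports Defs
begin

text \<open>With \<open>s = sqrt (\<parallel>x\<parallel>\<^sup>2 + 1)\<close>, the map \<open>x \<mapsto> (1 / s, x / s)\<close> sends \<open>T\<^sub>i\<close> into the compact set
  \<open>tT\<^sub>i\<close>. Disjoint compact sets are strictly separated by a polynomial \<open>g (x\<^sub>0, x)\<close>, by the theorems of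
  Urysohn and Stone--Weierstrass. Since \<open>s\<^sup>2\<close> is a polynomial in \<open>x\<close>, multiplying \<open>g (1 / s, x / s)\<close> by
  a sufficiently high power of \<open>s > 0\<close> gives a function of the form \<open>h\<^sub>1 + s h\<^sub>2\<close>, with the same sign.\<close>

lemma rpoly_eq_sum_single:
  "p = (\<Sum>m\<in>Poly_Mapping.keys p. Poly_Mapping.single m (Poly_Mapping.lookup p m))"
  by (rule poly_mapping_eqI)
    (simp add: lookup_sum lookup_single when_def in_keys_iff)

text \<open>Expanding both factors into single terms reduces the claim to the multiplicativity of
  \<open>monomial_eval\<close>.\<close>

lemma rpoly_eval_mult: "rpoly_eval a (p * q) = rpoly_eval a p * rpoly_eval a q"
proof -
  let ?t = "\<lambda>p m. Poly_Mapping.single m (Poly_Mapping.lookup p m) :: 'a rpoly"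
  have "p * q = (\<Sum>m\<in>Poly_Mapping.keys p. \<Sum>n\<in>Poly_Mapping.keys q. ?t p m * ?t q n)"
    by (subst rpoly_eq_sum_single[of p], subst rpoly_eq_sum_single[of q]) (rule sum_product)
  then show ?thesis
    by (simp add: rpoly_eval_sum mult_single monomial_eval_add rpoly_eval_def[of a p]
        rpoly_eval_def[of a q] sum_product mult_ac)
qed

lemma continuous_on_rpoly_eval:
  assumes "\<And>v. continuous_on A (\<lambda>x. a x v)"
  shows "continuous_on A (\<lambda>x. rpoly_eval (a x) p)"
  unfolding rpoly_eval_def monomial_eval_def
  by (intro continuous_intros assms)

definition radial :: "real ^ 'n::finite \<Rightarrow> real" where
  "radial x = sqrt ((norm x)\<^sup>2 + 1)"

lemma radial_pos: "radial x > 0"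
  by (simp add: radial_def add_nonneg_pos)

lemma radial_square: "(radial x)\<^sup>2 = (norm x)\<^sup>2 + 1"
  by (simp add: radial_def)

text \<open>These functions form the ring R[x][s] with \<open>s = radial x\<close>. Expressions of
  degree at most one in s suffice, since even powers of s are polynomials in x.\<close>

definition radical_polynomial :: "(real ^ 'n::finite \<Rightarrow> real) \<Rightarrow> bool" where
  "radical_polynomial f \<longleftrightarrow>
     (\<exists>h\<^sub>1 h\<^sub>2. \<forall>x. f x = rpoly_eval (($) x) h\<^sub>1 + radial x * rpoly_eval (($) x) h\<^sub>2)"

lemma radical_polynomialI:
  assumes "\<And>x. f x = rpoly_eval (($) x) h\<^sub>1 + radial x * rpoly_eval (($) x) h\<^sub>2"
  shows "radical_polynomial f"
  using assms unfolding radical_polynomial_def by blast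

lemma radical_polynomial_const: "radical_polynomial (\<lambda>x. c)"
  by (rule radical_polynomialI[where h\<^sub>1 = "Poly_Mapping.single 0 c" and h\<^sub>2 = 0]) simp

lemma radical_polynomial_radial: "radical_polynomial radial"
  by (rule radical_polynomialI[where h\<^sub>1 = 0 and h\<^sub>2 = "Poly_Mapping.single 0 1"])
    (simp del: single_one)

lemma radical_polynomial_coord: "radical_polynomial (\<lambda>x. x $ i)"
  by (rule radical_polynomialI[where h\<^sub>2 = 0 and
        h\<^sub>1 = "Poly_Mapping.single (Poly_Mapping.single i 1) 1"]) simp

lemma radical_polynomial_add:
  assumes "radical_polynomial f" "radical_polynomial g"
  shows "radical_polynomial (\<lambda>x. f x + g x)"
proof -
  from assms obtain p\<^sub>1 p\<^sub>2 q\<^sub>1 q\<^sub>2 where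
    "\<And>x. f x = rpoly_eval (($) x) p\<^sub>1 + radial x * rpoly_eval (($) x) p\<^sub>2"
    "\<And>x. g x = rpoly_eval (($) x) q\<^sub>1 + radial x * rpoly_eval (($) x) q\<^sub>2"
    unfolding radical_polynomial_def by blast
  then show ?thesis
    by (intro radical_polynomialI[where h\<^sub>1 = "p\<^sub>1 + q\<^sub>1" and h\<^sub>2 = "p\<^sub>2 + q\<^sub>2"])
      (simp add: rpoly_eval_add algebra_simps)
qed

lemma radical_polynomial_mult:
  assumes "radical_polynomial f" "radical_polynomial g"
  shows "radical_polynomial (\<lambda>x. f x * g x)"
proof -
  from assms obtain p\<^sub>1 p\<^sub>2 q\<^sub>1 q\<^sub>2 where
    fg: "\<And>x. f x = rpoly_eval (($) x) p\<^sub>1 + radial x * rpoly_eval (($) x) p\<^sub>2"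
    "\<And>x. g x = rpoly_eval (($) x) q\<^sub>1 + radial x * rpoly_eval (($) x) q\<^sub>2"
    unfolding radical_polynomial_def by blast
  \<comment> \<open>The polynomial 1 + (sum of all \<open>x $ i\<close> squared), which replaces the
    square of \<open>radial x\<close> in the product of the two s-terms.\<close>
  define r :: "'a rpoly" where
    "r = Poly_Mapping.single 0 1 + (\<Sum>i\<in>UNIV. Poly_Mapping.single (Poly_Mapping.single i 2) 1)"
  have r: "rpoly_eval (($) x) r = radial x * radial x" for x
    using radial_square[of x] power2_norm_eq_inner[of x]
    by (simp add: r_def rpoly_eval_add rpoly_eval_sum inner_vec_def power2_eq_square
        del: single_one)
  show ?thesis
    by (rule radical_polynomialI[where h\<^sub>1 = "p\<^sub>1 * q\<^sub>1 + r * (p\<^sub>2 * q\<^sub>2)" and h\<^sub>2 = "p\<^sub>1 * q\<^sub>2 + p\<^sub>2 * q\<^sub>1"])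
      (simp add: fg rpoly_eval_add rpoly_eval_mult r algebra_simps)
qed

lemma radical_polynomial_power:
  "radical_polynomial f \<Longrightarrow> radical_polynomial (\<lambda>x. f x ^ n)"
  by (induction n) (auto intro: radical_polynomial_const radical_polynomial_mult)

lemma radical_polynomial_sum:
  "(\<And>i. i \<in> I \<Longrightarrow> radical_polynomial (f i)) \<Longrightarrow> radical_polynomial (\<lambda>x. \<Sum>i\<in>I. f i x)"
  by (induction I rule: infinite_finite_induct)
    (auto intro: radical_polynomial_const radical_polynomial_add)

text \<open>The central projection of the hyperplane \<open>x0 = 1\<close> to the open upper unit
  hemisphere: \<open>radial x\<close> is the norm of \<open>(1, x)\<close>.\<close>

definition sphere_point :: "real ^ 'n::finite \<Rightarrow> real \<times> (real ^ 'n)" where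
  "sphere_point x = (1 / radial x, x /\<^sub>R radial x)"

text \<open>Multiplying by a power of \<open>radial x\<close> clears the denominators that
  \<open>sphere_point\<close> introduces. The induction follows the generation of polynomial
  functions from linear ones and constants.\<close>

lemma radial_power_times_polynomial:
  fixes g :: "real \<times> (real ^ 'n::finite) \<Rightarrow> real"
  assumes "real_polynomial_function g"
  shows "\<exists>n. radical_polynomial (\<lambda>x. radial x ^ n * g (sphere_point x))"
  using assms
proof (induction rule: real_polynomial_function.induct)
  case (linear f)
  interpret bounded_linear f by fact
  \<comment> \<open>By linearity one factor \<open>radial x\<close> rescales the argument to
    \<open>(1, x)\<close>, where f becomes an affine function of the coordinates of x.\<close>
  have "radial x ^ 1 * f (sphere_point x) = f (1, 0) + (\<Sum>i\<in>UNIV. f (0, axis i 1) * x $ i)" for x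
  proof -
    have "radial x ^ 1 * f (sphere_point x) = f (radial x *\<^sub>R sphere_point x)"
      by (simp add: scaleR)
    also have "radial x *\<^sub>R sphere_point x = (1, x)"
      using radial_pos[of x] by (simp add: sphere_point_def)
    also have "(1, x) = (1, 0) + (\<Sum>i\<in>UNIV. x $ i *\<^sub>R (0, axis i 1))"
      using basis_expansion[of x]
      by (simp add: prod_eq_iff fst_sum snd_sum scalar_mult_eq_scaleR)
    finally show ?thesis
      by (simp only: add sum scaleR) (simp add: mult.commute)
  qed
  then show ?case
    by (intro exI[of _ 1])
      (simp only:, intro radical_polynomial_add radical_polynomial_const radical_polynomial_sum
        radical_polynomial_mult radical_polynomial_coord)
next
  case (const c)
  then show ?case
    by (intro exI[of _ 0]) (simp add: radical_polynomial_const)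
next
  case (add f g)
  then obtain m n where fg:
    "radical_polynomial (\<lambda>x. radial x ^ m * f (sphere_point x))"
    "radical_polynomial (\<lambda>x. radial x ^ n * g (sphere_point x))"
    by blast
  \<comment> \<open>Each summand receives the power that clears the other one, so both carry the
    exponent \<open>m + n\<close>.\<close>
  have "radical_polynomial (\<lambda>x. radial x ^ n * (radial x ^ m * f (sphere_point x))
      + radial x ^ m * (radial x ^ n * g (sphere_point x)))"
    using radical_polynomial_power[OF radical_polynomial_radial]
    by (intro radical_polynomial_add fg[THEN radical_polynomial_mult[rotated]])
  then show ?case
    by (intro exI[of _ "m + n"]) (simp add: power_add algebra_simps)
next
  case (mult f g)
  then obtain m n where
    "radical_polynomial (\<lambda>x. radial x ^ m * f (sphere_point x))"
    "radical_polynomial (\<lambda>x. radial x ^ n * g (sphere_point x))"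
    by blast
  then have "radical_polynomial (\<lambda>x. (radial x ^ m * f (sphere_point x))
      * (radial x ^ n * g (sphere_point x)))"
    by (rule radical_polynomial_mult)
  then show ?case
    by (intro exI[of _ "m + n"]) (simp add: power_add mult_ac)
qed

text \<open>By homogeneity, the homogenization of p takes at \<open>sphere_point x\<close> the value
  \<open>p(x)\<close> times a power of \<open>1 / radial x\<close>. That factor is positive, so the
  inequality for p carries over.\<close>

lemma sphere_point_in_tilde_set:
  assumes "x \<in> basic_sa_set ps"
  shows "sphere_point x \<in> tilde_set ps"
proof -
  have pos: "radial x > 0"
    by (rule radial_pos)
  have "rpoly_eval (case_option (1 / radial x) (($) (x /\<^sub>R radial x))) (homogenize p) \<ge> 0"
    if "p \<in> set ps" for p
  proof -
    \<comment> \<open>Dehomogenizing, that is, dividing by the coordinate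
      \<open>1 / radial x\<close>, gives back the original point.\<close>
    have "(\<lambda>v. (x /\<^sub>R radial x) $ v / (1 / radial x)) = ($) x"
      using pos by auto
    then show ?thesis
      using assms that pos by (subst rpoly_eval_homogenize) (auto simp: basic_sa_set_def)
  qed
  moreover have "(1 / radial x)\<^sup>2 + (norm (x /\<^sub>R radial x))\<^sup>2 = 1"
  proof -
    have "(1 / radial x)\<^sup>2 + (norm (x /\<^sub>R radial x))\<^sup>2 = ((norm x)\<^sup>2 + 1) / (radial x)\<^sup>2"
      using pos by (simp add: power_mult_distrib power_divide divide_simps)
    also have "\<dots> = 1"
      using pos by (simp flip: radial_square)
    finally show ?thesis .
  qed
  ultimately show ?thesis
    using pos by (simp add: tilde_set_def sphere_point_def)
qed

text \<open>The inequalities are closed conditions because evaluation is continuous in the point,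
  and the norm equation says that the point lies on the unit sphere of the product space, which is
  compact.\<close>

lemma compact_tilde_set: "compact (tilde_set ps)"
proof -
  have "continuous_on UNIV (\<lambda>z :: real \<times> (real ^ 'a). rpoly_eval (case_option (fst z) (($) (snd z))) q)"
    for q
  proof (rule continuous_on_rpoly_eval)
    show "continuous_on UNIV (\<lambda>z :: real \<times> (real ^ 'a). case_option (fst z) (($) (snd z)) v)" for v
      by (cases v) (auto intro!: continuous_intros)
  qed
  then have "closed (\<Inter>p\<in>set ps. {z :: real \<times> (real ^ 'a).
      0 \<le> rpoly_eval (case_option (fst z) (($) (snd z))) (homogenize p)})"
    by (intro closed_INT ballI closed_Collect_le continuous_intros)
  moreover have "closed {z :: real \<times> (real ^ 'a). 0 \<le> fst z}"
    by (intro closed_Collect_le continuous_intros)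
  moreover have "tilde_set ps = (\<Inter>p\<in>set ps. {z.
      0 \<le> rpoly_eval (case_option (fst z) (($) (snd z))) (homogenize p)}) \<inter> {z. 0 \<le> fst z} \<inter> sphere 0 1"
    by (auto simp: tilde_set_def norm_prod_def)
  ultimately show ?thesis
    by (simp only: closed_Int closed_Int_compact compact_sphere)
qed

lemma polynomial_separates_disjoint_compacts:
  fixes A B :: "'a::euclidean_space set"
  assumes "compact A" "compact B" "A \<inter> B = {}"
  obtains g where "real_polynomial_function g" "\<And>z. z \<in> A \<Longrightarrow> g z > 0" "\<And>z. z \<in> B \<Longrightarrow> g z < 0"
proof -
  obtain f :: "'a \<Rightarrow> real" where f: "continuous_on UNIV f"
    "\<And>z. z \<in> A \<Longrightarrow> f z = 1" "\<And>z. z \<in> B \<Longrightarrow> f z = -1"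
    using Urysohn[of A B 1 "-1"] assms compact_imp_closed by metis
  have "compact (A \<union> B)" "continuous_on (A \<union> B) f"
    using assms f(1) continuous_on_subset[of UNIV f] by auto
  \<comment> \<open>As f is 1 on A and -1 on B, an error strictly below 1 keeps g positive on A and
    negative on B.\<close>
  then obtain g where "real_polynomial_function g" "\<And>z. z \<in> A \<union> B \<Longrightarrow> \<bar>f z - g z\<bar> < 1"
    using Stone_Weierstrass_real_polynomial_function[of "A \<union> B" f 1] by auto
  with f that[of g] show ?thesis
    by (smt (verit) UnCI)
qed

theorem theorem3:
  fixes \<phi> :: "('r1::finite + 'r2::finite) rpoly list list"
    and \<psi> :: "('r1 + 'r3::finite) rpoly list list"
    and Ss Ss' :: "'r1 rpoly list list"
    and T\<^sub>1 T\<^sub>2 :: "(real ^ 'r1) set"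
    and tT\<^sub>1 tT\<^sub>2 :: "(real \<times> (real ^ 'r1)) set"
  assumes "T\<^sub>1 = closure (proj_x (solution_set \<phi>))"
    and "T\<^sub>2 = closure (proj_x (solution_set \<psi>))"
    and "T\<^sub>1 = (\<Union>S\<in>set Ss. basic_sa_set S)"
    and "T\<^sub>2 = (\<Union>S\<in>set Ss'. basic_sa_set S)"
    and "tT\<^sub>1 = (\<Union>S\<in>set Ss. tilde_set S)"
    and "tT\<^sub>2 = (\<Union>S\<in>set Ss'. tilde_set S)"
    and "tT\<^sub>1 \<inter> tT\<^sub>2 = {}"
  shows "\<exists>(h\<^sub>1 :: 'r1 rpoly) (h\<^sub>2 :: 'r1 rpoly).
    let h = (\<lambda>x :: real ^ 'r1.
      rpoly_eval (($) x) h\<^sub>1 + sqrt ((norm x)\<^sup>2 + 1) * rpoly_eval (($) x) h\<^sub>2)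
    in (\<forall>x\<in>proj_x (solution_set \<phi>). h x > 0) \<and>
       (\<forall>x\<in>proj_x (solution_set \<psi>). - h x > 0) \<and>
       (\<forall>x y. holds \<phi> x y \<longrightarrow> h x > 0) \<and>
       (\<forall>x z. holds \<psi> x z \<longrightarrow> h x < 0)"
proof -
  have "compact tT\<^sub>1" "compact tT\<^sub>2"
    using assms(5,6) by (auto intro: compact_UN compact_tilde_set)
  then obtain g where g: "real_polynomial_function g"
    "\<And>z. z \<in> tT\<^sub>1 \<Longrightarrow> g z > 0" "\<And>z. z \<in> tT\<^sub>2 \<Longrightarrow> g z < 0"
    using polynomial_separates_disjoint_compacts assms(7) by blast
  \<comment> \<open>The factor \<open>radial x ^ n\<close> is positive, so h has at x the sign of g
    at \<open>sphere_point x\<close>.\<close>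
  obtain n h\<^sub>1 h\<^sub>2 where h: "\<And>x. radial x ^ n * g (sphere_point x) =
      rpoly_eval (($) x) h\<^sub>1 + radial x * rpoly_eval (($) x) h\<^sub>2"
    using radial_power_times_polynomial[OF g(1)] unfolding radical_polynomial_def by blast
  let ?h = "\<lambda>x. rpoly_eval (($) x) h\<^sub>1 + sqrt ((norm x)\<^sup>2 + 1) * rpoly_eval (($) x) h\<^sub>2"
  have "?h x > 0" if "x \<in> proj_x (solution_set \<phi>)" for x
  proof -
    have "x \<in> T\<^sub>1"
      using that assms(1) closure_subset by blast
    then have "sphere_point x \<in> tT\<^sub>1"
      using assms(3,5) sphere_point_in_tilde_set by blast
    then show ?thesis
      using g(2) radial_pos[of x] h[of x] by (simp flip: radial_def h)
  qed
  moreover have "?h x < 0" if "x \<in> proj_x (solution_set \<psi>)" for x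
  proof -
    have "x \<in> T\<^sub>2"
      using that assms(2) closure_subset by blast
    then have "sphere_point x \<in> tT\<^sub>2"
      using assms(4,6) sphere_point_in_tilde_set by blast
    then show ?thesis
      using g(3) radial_pos[of x] by (simp flip: radial_def h add: mult_pos_neg)
  qed
  ultimately show ?thesis
    unfolding Let_def
    \<comment> \<open>The two entailments are the sign statements again: a solution of either
      formula puts its x-part into the projection.\<close>
    by - (rule exI[of _ h\<^sub>1], rule exI[of _ h\<^sub>2],
        auto simp: proj_x_def solution_set_def simp flip: neg_0_less_iff_less)
qed

end
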